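(* Let the pair $\{x,x_1\}$ be a Mannheim $D$-pair in $E^3$, with $\lambda$ the nonzero constant for which $\vec x=\vec x_1+\lambda\vec n_1$ at corresponding points. Then the geodesic curvature $k_g$ and geodesic torsion $\tau_g$ of $x(s)$ and the normal curvature $k_{n_1}$ and geodesic torsion $\tau_{g_1}$ of $x_1(s_1)$ satisfy, at corresponding points, $$k_g - k_{n_1} = \lambda\,(k_g k_{n_1} - \tau_g \tau_{g_1}).$$
   Context: $E^3$ is Euclidean 3-space. For an arc length parametrized curve $x(s)$ lying on an oriented surface $S$, the Darboux frame $\{\vec T,\vec g,\vec n\}$ consists of the unit tangent $\vec T$ of $x$, the unit normal $\vec n$ of $S$ along $x$, and $\vec g=\vec n\times\vec T$. The geodesic curvature $k_g$, normal curvature $k_n$ and geodesic torsion $\tau_g$ are defined by $$\frac{d\vec T}{ds}=k_g\vec g+k_n\vec n,\quad \frac{d\vec g}{ds}=-k_g\vec T+\tau_g\vec n,\quad \frac{d\vec n}{ds}=-k_n\vec T-\tau_g\vec g.$$ For $x_1(s_1)$ on $S_1$ the corresponding objects are denoted $\{\vec T_1,\vec g_1,\vec n_1\}$, $k_{g_1},k_{n_1},\tau_{g_1}$ (derivatives with respect to $s_1$). Definition (Mannheim partner $D$-curves). Let $x(s)$ and $x_1(s_1)$ be arc length parametrized curves lying fully on oriented surfaces $S$ and $S_1$. If there is a correspondence between the points of $x$ and $x_1$ (so that $s$ is a function of $s_1$) such that at corresponding points the Darboux frame element $\vec g$ of $x$ coincides with the Darboux frame element $\vec n_1$ of $x_1$,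 then $x$ is called a Mannheim $D$-curve, $x_1$ a Mannheim partner $D$-curve of $x$, and $\{x,x_1\}$ a Mannheim $D$-pair. Coincidence is understood along a common line: corresponding points are related by $\vec x(s(s_1))=\vec x_1(s_1)+\lambda\,\vec n_1(s_1)$, where for a Mannheim $D$-pair $\lambda$ is a nonzero constant. *)

theory Defs
  imports "HOL-Analysis.Analysis"
begin

text \<open>
  Class \<open>C\<^sup>k\<close> on an open set, by recursion on the partial derivatives.
\<close>
fun Ck_on :: "nat \<Rightarrow> ('a::euclidean_space \<Rightarrow> 'b::real_normed_vector) \<Rightarrow> 'a set \<Rightarrow> bool" where
  "Ck_on 0 f U \<longleftrightarrow> continuous_on U f"
| "Ck_on (Suc k) f U \<longleftrightarrow> f differentiable_on U \<and>
     (\<forall>i\<in>Basis. Ck_on k (\<lambda>u. frechet_derivative f (at u) i) U)"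

definition local_parametrization ::
  "(real^3) set \<Rightarrow> (real^3) set \<Rightarrow> (real^2) set \<Rightarrow> (real^2 \<Rightarrow> real^3) \<Rightarrow> bool" where
  "local_parametrization S V U X \<longleftrightarrow>
     open V \<and> open U \<and> Ck_on 2 X U \<and> (\<exists>Y. homeomorphism U (S \<inter> V) X Y) \<and>
     (\<forall>u\<in>U. inj (frechet_derivative X (at u)))"

text \<open>
  A regular surface of class \<open>C\<^sup>2\<close> (every smooth surface is one), oriented by a continuous
  unit normal field \<open>N\<close>; only the values of \<open>N\<close> on \<open>S\<close> matter.
\<close>
definition oriented_surface :: "(real^3) set \<Rightarrow> (real^3 \<Rightarrow> real^3) \<Rightarrow> bool" where
  "oriented_surface S N \<longleftrightarrow>
     continuous_on S N \<and> (\<forall>p\<in>S. norm (N p) = 1) \<and>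
     (\<forall>p\<in>S. \<exists>V U X. p \<in> V \<and> local_parametrization S V U X \<and>
        (\<forall>u\<in>U. \<forall>h. N (X u) \<bullet> frechet_derivative X (at u) h = 0))"

definition arc_length_curve_on :: "(real^3) set \<Rightarrow> (real \<Rightarrow> real^3) \<Rightarrow> real set \<Rightarrow> bool" where
  "arc_length_curve_on S x I \<longleftrightarrow>
     open I \<and> is_interval I \<and> I \<noteq> {} \<and> x ` I \<subseteq> S \<and>
     (\<forall>s\<in>I. x differentiable (at s) \<and> norm (vector_derivative x (at s)) = 1)"

definition darboux_T :: "(real \<Rightarrow> real^3) \<Rightarrow> real \<Rightarrow> real^3" where
  "darboux_T x s = vector_derivative x (at s)"

definition darboux_n :: "(real^3 \<Rightarrow> real^3) \<Rightarrow> (real \<Rightarrow> real^3) \<Rightarrow> real \<Rightarrow> real^3" where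
  "darboux_n N x s = N (x s)"

definition darboux_g :: "(real^3 \<Rightarrow> real^3) \<Rightarrow> (real \<Rightarrow> real^3) \<Rightarrow> real \<Rightarrow> real^3" where
  "darboux_g N x s = cross3 (darboux_n N x s) (darboux_T x s)"

text \<open>
  \<open>kg\<close>, \<open>kn\<close>, \<open>tg\<close> are the geodesic curvature, normal curvature and geodesic torsion of the
  curve \<open>x\<close> on the surface with unit normal \<open>N\<close>.  As the frame is orthonormal, the equations
  determine these functions uniquely on \<open>I\<close>.
\<close>
definition darboux_curvatures ::
  "(real^3 \<Rightarrow> real^3) \<Rightarrow> (real \<Rightarrow> real^3) \<Rightarrow> real set \<Rightarrow>
   (real \<Rightarrow> real) \<Rightarrow> (real \<Rightarrow> real) \<Rightarrow> (real \<Rightarrow> real) \<Rightarrow> bool" where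
  "darboux_curvatures N x I kg kn tg \<longleftrightarrow> (\<forall>s\<in>I.
     (darboux_T x has_vector_derivative
        kg s *\<^sub>R darboux_g N x s + kn s *\<^sub>R darboux_n N x s) (at s) \<and>
     (darboux_g N x has_vector_derivative
        - kg s *\<^sub>R darboux_T x s + tg s *\<^sub>R darboux_n N x s) (at s) \<and>
     (darboux_n N x has_vector_derivative
        - kn s *\<^sub>R darboux_T x s - tg s *\<^sub>R darboux_g N x s) (at s))"

text \<open>
  The correspondence is the differentiable function \<open>s = \<sigma> s\<^sub>1\<close>: the point \<open>x (\<sigma> s\<^sub>1)\<close>
  corresponds to \<open>x\<^sub>1 s\<^sub>1\<close>.  The frame vectors coincide as vectors along a common line, at the
  constant signed distance \<open>l\<close>.
\<close>
definition mannheim_D_pair ::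
  "(real^3) set \<Rightarrow> (real^3 \<Rightarrow> real^3) \<Rightarrow> (real \<Rightarrow> real^3) \<Rightarrow> real set \<Rightarrow>
   (real^3) set \<Rightarrow> (real^3 \<Rightarrow> real^3) \<Rightarrow> (real \<Rightarrow> real^3) \<Rightarrow> real set \<Rightarrow>
   (real \<Rightarrow> real) \<Rightarrow> real \<Rightarrow> bool" where
  "mannheim_D_pair S N x I S1 N1 x1 I1 \<sigma> l \<longleftrightarrow>
     oriented_surface S N \<and> arc_length_curve_on S x I \<and>
     oriented_surface S1 N1 \<and> arc_length_curve_on S1 x1 I1 \<and>
     \<sigma> ` I1 = I \<and> \<sigma> differentiable_on I1 \<and> l \<noteq> 0 \<and>
     (\<forall>s1\<in>I1. darboux_g N x (\<sigma> s1) = darboux_n N1 x1 s1 \<and>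
        x (\<sigma> s1) = x1 s1 + l *\<^sub>R darboux_n N1 x1 s1)"

end

theory Submission
  imports Defs
begin

text \<open>
  Write \<open>d\<close> for the derivative of the correspondence \<open>\<sigma>\<close> at \<open>s\<^sub>1\<close>.  Along the curve \<open>x\<^sub>1\<close> there
  are two identities, \<open>x \<circ> \<sigma> = x\<^sub>1 + l n\<^sub>1\<close> and \<open>g \<circ> \<sigma> = n\<^sub>1\<close>.  Differentiating both and inserting
  the Darboux equations gives
  \<open>d T = (1 - l k\<^sub>n\<^sub>1) T\<^sub>1 - l \<tau>\<^sub>g\<^sub>1 g\<^sub>1\<close> and \<open>d (- k\<^sub>g T + \<tau>\<^sub>g n) = - k\<^sub>n\<^sub>1 T\<^sub>1 - \<tau>\<^sub>g\<^sub>1 g\<^sub>1\<close>.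
  Since \<open>n = T \<times> g = T \<times> n\<^sub>1\<close>, a quarter turn about the common line turns the first identity
  into \<open>d n = - (1 - l k\<^sub>n\<^sub>1) g\<^sub>1 - l \<tau>\<^sub>g\<^sub>1 T\<^sub>1\<close>.  Inserting both into the second identity and
  comparing the components along \<open>T\<^sub>1\<close> gives
  \<open>- k\<^sub>g (1 - l k\<^sub>n\<^sub>1) - l \<tau>\<^sub>g \<tau>\<^sub>g\<^sub>1 = - k\<^sub>n\<^sub>1\<close>, which is the claim.  The factor \<open>d\<close> is never divided
  out, so points where \<open>\<sigma>\<close> might be singular need no separate treatment.

  The computation uses that the two frames are orthonormal, which the coincidence of \<open>g\<close> with
  \<open>n\<^sub>1\<close> forces: \<open>T\<close> and \<open>n\<close> are unit vectors whose cross product \<open>g = n\<^sub>1\<close> has length \<open>1\<close>, so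
  they are orthogonal
  (\<open>orthogonal_if_unit_cross3\<close>), and \<open>T\<^sub>1 = d (T - l g')\<close> is a combination of \<open>T\<close> and \<open>n\<close>,
  hence orthogonal to \<open>g = n\<^sub>1\<close>.  The algebra at one point is \<open>mannheim_frame_relation\<close>.
\<close>

lemma orthogonal_if_unit_cross3:
  assumes "norm a = 1" "norm b = 1" "norm (cross3 a b) = 1"
  shows "a \<bullet> b = 0"
  using norm_cross_dot[of a b] assms by simp

text \<open>
  The pointwise content of the theorem.  The vectors \<open>T, n, T1, n1\<close> and the number \<open>d\<close> stand for
  the frames at corresponding points and the derivative of the correspondence; the last two
  assumptions are the derivatives of \<open>x \<circ> \<sigma> = x\<^sub>1 + l n\<^sub>1\<close> and \<open>g \<circ> \<sigma> = n\<^sub>1\<close>.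
\<close>
lemma mannheim_frame_relation:
  fixes T n T1 n1 :: "real^3" and d l kg tg kn1 tg1 :: real
  defines "g1 \<equiv> cross3 n1 T1"
  assumes unit: "norm T = 1" "norm n = 1" "norm T1 = 1" "norm n1 = 1"
    and coincide: "cross3 n T = n1"
    and position: "d *\<^sub>R T = T1 + l *\<^sub>R (- kn1 *\<^sub>R T1 - tg1 *\<^sub>R g1)"
    and direction: "d *\<^sub>R (- kg *\<^sub>R T + tg *\<^sub>R n) = - kn1 *\<^sub>R T1 - tg1 *\<^sub>R g1"
  shows "kg - kn1 = l * (kg * kn1 - tg * tg1)"
proof -
  have nT: "n \<bullet> T = 0"
    using orthogonal_if_unit_cross3 unit coincide by simp
  have Tn1: "T \<bullet> n1 = 0" and nn1: "n \<bullet> n1 = 0"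
    unfolding coincide[symmetric] by (rule dot_cross_self)+
  \<comment> \<open>The direction equation places the derivative of \<open>n1\<close> in the plane of \<open>T\<close> and \<open>n\<close>, and then
    the position equation places \<open>T1\<close> there too.\<close>
  have "(- kn1 *\<^sub>R T1 - tg1 *\<^sub>R g1) \<bullet> n1 = 0"
    unfolding direction[symmetric] by (simp add: inner_diff_left Tn1 nn1)
  then have T1n1: "T1 \<bullet> n1 = 0"
    using arg_cong[OF position, of "\<lambda>v. v \<bullet> n1"] by (simp add: inner_add_left Tn1)
  have g1T1: "g1 \<bullet> T1 = 0"
    unfolding g1_def by (simp add: dot_cross_self)
  have T1T1: "T1 \<bullet> T1 = 1"
    using unit by (simp add: dot_square_norm)
  have g1g1: "g1 \<bullet> g1 = 1"
    using norm_cross_dot[of n1 T1] unit T1n1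
    by (simp add: g1_def dot_square_norm inner_commute)
  \<comment> \<open>The quarter turn about the common line takes \<open>T\<close> to \<open>n\<close>; read through the triple product,
    the component of \<open>n\<close> along \<open>T1\<close> is the component of \<open>T\<close> along \<open>g1\<close>.\<close>
  have "cross3 T n1 = n"
    using unit nT unfolding coincide[symmetric]
    by (simp add: Lagrange dot_square_norm inner_commute)
  then have "n \<bullet> T1 = T \<bullet> g1"
    using cross_triple[of T n1 T1]
    by (simp add: g1_def inner_commute)
  then have "d * (n \<bullet> T1) = (d *\<^sub>R T) \<bullet> g1" by simp
  also have "\<dots> = - l * tg1"
    unfolding position using g1T1 g1g1 by (simp add: algebra_simps inner_commute)
  finally have dn: "d * (n \<bullet> T1) = - l * tg1" .
  have "d * (T \<bullet> T1) = (d *\<^sub>R T) \<bullet> T1" by simp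
  also have "\<dots> = 1 - l * kn1"
    unfolding position using g1T1 T1T1 by (simp add: algebra_simps)
  finally have dT: "d * (T \<bullet> T1) = 1 - l * kn1" .
  have "- kg * (d * (T \<bullet> T1)) + tg * (d * (n \<bullet> T1)) = - kn1"
    using arg_cong[OF direction, of "\<lambda>v. v \<bullet> T1"] g1T1 T1T1 by (simp add: algebra_simps)
  then show ?thesis
    unfolding dT dn by (simp add: algebra_simps)
qed

text \<open>
  The curve points must lie on the surface here, because the normal field has unit length only
  there.
\<close>
lemma unit_frame_vectors:
  assumes "oriented_surface S N" "arc_length_curve_on S x I" "s \<in> I"
  shows "norm (darboux_T x s) = 1" "norm (darboux_n N x s) = 1"
  using assms
  by (auto simp: oriented_surface_def arc_length_curve_on_def darboux_T_def darboux_n_def)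

lemma arc_length_curve_has_derivative_T:
  assumes "arc_length_curve_on S x I" "s \<in> I"
  shows "(x has_vector_derivative darboux_T x s) (at s)"
  using assms by (simp add: arc_length_curve_on_def darboux_T_def vector_derivative_works)

text \<open>
  How an identity between the two curves is differentiated: the chain rule on one side, uniqueness
  of derivatives on an open set of parameters on the other.
\<close>
lemma chain_rule_identity:
  fixes f h :: "real \<Rightarrow> 'a::real_normed_vector"
  assumes "open I" "s \<in> I" and eq: "\<And>t. t \<in> I \<Longrightarrow> f (\<sigma> t) = h t"
    and \<sigma>: "(\<sigma> has_vector_derivative d) (at s)"
    and f: "(f has_vector_derivative f') (at (\<sigma> s))"
    and h: "(h has_vector_derivative h') (at s)"
  shows "d *\<^sub>R f' = h'"
proof -
  have "((f \<circ> \<sigma>) has_vector_derivative h') (at s)"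
    using has_vector_derivative_transform_within_open[OF h assms(1,2)] eq by simp
  then show ?thesis
    using vector_diff_chain_at[OF \<sigma> f] vector_derivative_unique_at by blast
qed

theorem theorem2:
  fixes S S1 :: "(real^3) set" and N N1 :: "real^3 \<Rightarrow> real^3"
    and x x1 :: "real \<Rightarrow> real^3" and I I1 :: "real set"
    and \<sigma> :: "real \<Rightarrow> real" and l :: real
    and kg kn tg kg1 kn1 tg1 :: "real \<Rightarrow> real"
  assumes "mannheim_D_pair S N x I S1 N1 x1 I1 \<sigma> l"
    and "darboux_curvatures N x I kg kn tg"
    and "darboux_curvatures N1 x1 I1 kg1 kn1 tg1"
  shows "\<forall>s1\<in>I1. kg (\<sigma> s1) - kn1 s1 = l * (kg (\<sigma> s1) * kn1 s1 - tg (\<sigma> s1) * tg1 s1)"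
proof
  fix s1 assume s1: "s1 \<in> I1"
  have surf: "oriented_surface S N" "oriented_surface S1 N1"
    and curve: "arc_length_curve_on S x I" "arc_length_curve_on S1 x1 I1"
    and onto: "\<sigma> ` I1 = I" and diff: "\<sigma> differentiable_on I1"
    and g: "\<And>t. t \<in> I1 \<Longrightarrow> darboux_g N x (\<sigma> t) = darboux_n N1 x1 t"
    and pos: "\<And>t. t \<in> I1 \<Longrightarrow> x (\<sigma> t) = x1 t + l *\<^sub>R darboux_n N1 x1 t"
    using assms(1) unfolding mannheim_D_pair_def by auto
  have I1: "open I1"
    using curve(2) by (simp add: arc_length_curve_on_def)
  have s: "\<sigma> s1 \<in> I"
    using onto s1 by blast
  define d where "d = vector_derivative \<sigma> (at s1)"
  have \<sigma>: "(\<sigma> has_vector_derivative d) (at s1)"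
    using diff I1 s1 unfolding d_def
    by (simp add: differentiable_on_eq_differentiable_at vector_derivative_works)
  let ?n1' = "- kn1 s1 *\<^sub>R darboux_T x1 s1 - tg1 s1 *\<^sub>R darboux_g N1 x1 s1"
  have n1': "(darboux_n N1 x1 has_vector_derivative ?n1') (at s1)"
    using assms(3) s1 by (simp add: darboux_curvatures_def)
  have g': "(darboux_g N x has_vector_derivative
      - kg (\<sigma> s1) *\<^sub>R darboux_T x (\<sigma> s1) + tg (\<sigma> s1) *\<^sub>R darboux_n N x (\<sigma> s1)) (at (\<sigma> s1))"
    using assms(2) s by (simp add: darboux_curvatures_def)
  have "((\<lambda>t. x1 t + l *\<^sub>R darboux_n N1 x1 t) has_vector_derivative
      darboux_T x1 s1 + l *\<^sub>R ?n1') (at s1)"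
    using has_vector_derivative_add[OF arc_length_curve_has_derivative_T[OF curve(2) s1]
        has_vector_derivative_scaleR[OF DERIV_const n1']] by simp
  then have position: "d *\<^sub>R darboux_T x (\<sigma> s1) = darboux_T x1 s1 + l *\<^sub>R ?n1'"
    using chain_rule_identity[OF I1 s1 pos \<sigma> arc_length_curve_has_derivative_T[OF curve(1) s]]
    by blast
  have direction: "d *\<^sub>R (- kg (\<sigma> s1) *\<^sub>R darboux_T x (\<sigma> s1)
      + tg (\<sigma> s1) *\<^sub>R darboux_n N x (\<sigma> s1)) = ?n1'"
    by (rule chain_rule_identity[OF I1 s1 g \<sigma> g' n1'])
  show "kg (\<sigma> s1) - kn1 s1 = l * (kg (\<sigma> s1) * kn1 s1 - tg (\<sigma> s1) * tg1 s1)"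
    using mannheim_frame_relation[OF unit_frame_vectors[OF surf(1) curve(1) s]
        unit_frame_vectors[OF surf(2) curve(2) s1]
        g[OF s1, unfolded darboux_g_def] position[unfolded darboux_g_def]
        direction[unfolded darboux_g_def]] .
qed

end
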